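(* For $n\ge1$ let $\mathcal{C}_n$ be the collection of closed convex subsets of $\mathbb{R}^n$ which are symmetric about the origin. Assume that there is a sequence $(c_n)_{n\ge1}$ of positive numbers with $\lim_{n\to\infty}c_n^{1/n}=1$ such that $\mu_n(A\cap B)\ge c_n\,\mu_n(A)\mu_n(B)$ for all $n\in\mathbb{N}$ and all $A,B\in\mathcal{C}_n$. Then, for all $n\in\mathbb{N}$ and all $A,B\in\mathcal{C}_n$, $$\mu_n(A\cap B)\ \ge\ \mu_n(A)\,\mu_n(B).$$
   Context: $\mu_n$ denotes the standard Gaussian measure on $\mathbb{R}^n$, $\mu_n(A)=(2\pi)^{-n/2}\int_A e^{-|x|^2/2}\,dx$. A set $A$ is symmetric about the origin if $A=-A$. *)

theory Defs
  imports "HOL-Probability.Probability"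
begin

text \<open>
  The dimension \<open>n\<close> is quantified inside the statement, so a point of \<open>\<real>\<^sup>n\<close> is a function
  \<open>nat \<Rightarrow> real\<close> on the index set \<open>{..<n}\<close>, equal to \<open>undefined\<close> outside it. This is the carrier
  of both \<open>PiM {..<n} (\<lambda>_. lborel)\<close> and the product topology \<open>powertop_real {..<n}\<close>.
\<close>

definition gauss_measure :: "nat \<Rightarrow> (nat \<Rightarrow> real) measure" where
  "gauss_measure n =
     density (PiM {..<n} (\<lambda>_. lborel))
       (\<lambda>x. ennreal ((2 * pi) powr (- real n / 2) * exp (- (\<Sum>i<n. (x i)\<^sup>2) / 2)))"

definition convex_Rn :: "nat \<Rightarrow> (nat \<Rightarrow> real) set \<Rightarrow> bool" where
  "convex_Rn n A \<longleftrightarrow>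
     (\<forall>x\<in>A. \<forall>y\<in>A. \<forall>u\<ge>0. \<forall>v\<ge>0. u + v = 1 \<longrightarrow> (\<lambda>i\<in>{..<n}. u * x i + v * y i) \<in> A)"

definition symmetric_Rn :: "nat \<Rightarrow> (nat \<Rightarrow> real) set \<Rightarrow> bool" where
  "symmetric_Rn n A \<longleftrightarrow> A = (\<lambda>x. \<lambda>i\<in>{..<n}. - x i) ` A"

definition sym_closed_convex :: "nat \<Rightarrow> (nat \<Rightarrow> real) set set" where
  "sym_closed_convex n =
     {A. closedin (powertop_real {..<n}) A \<and> convex_Rn n A \<and> symmetric_Rn n A}"

text \<open>
  The real-valued \<open>measure (gauss_measure n)\<close> is \<open>0\<close> by default on non-measurable sets and on
  sets of infinite measure. Neither occurs here: closed sets are measurable and the measure is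
  finite.
\<close>

lemma closedin_imp_sets_gauss_measure:
  assumes "closedin (powertop_real {..<n}) A"
  shows "A \<in> sets (gauss_measure n)"
proof -
  let ?r = "\<lambda>x::nat \<Rightarrow> real. restrict x {..<n}"
  let ?e = "\<lambda>x::nat \<Rightarrow> real. \<lambda>i. if i < n then x i else 0"
  let ?M = "PiM {..<n} (\<lambda>_. lborel :: real measure)"
  have sub: "A \<subseteq> (\<Pi>\<^sub>E i\<in>{..<n}. UNIV)"
    using closedin_subset[OF assms] by simp
  have "continuous_map (powertop_real UNIV) (powertop_real {..<n}) ?r"
    by (auto simp: continuous_map_componentwise intro: continuous_map_product_projection)
  from closedin_continuous_map_preimage[OF this assms]
  have "closed {x. ?r x \<in> A}"
    by (simp add: euclidean_product_topology)
  then have 1: "{x. ?r x \<in> A} \<in> sets (PiM UNIV (\<lambda>_. borel))"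
    by (subst sets_PiM_equal_borel) (rule borel_closed)
  have 2: "?e \<in> measurable ?M (PiM UNIV (\<lambda>_. borel))"
  proof (rule measurable_PiM_single')
    fix i :: nat
    show "(\<lambda>x. ?e x i) \<in> borel_measurable ?M"
      by (cases "i < n") auto
  qed (auto simp: space_PiM)
  have "?r (?e x) = x" if "x \<in> space ?M" for x
    using that by (auto simp: space_PiM PiE_def extensional_def fun_eq_iff)
  then have "?e -` {x. ?r x \<in> A} \<inter> space ?M = A \<inter> space ?M"
    by auto
  also have "\<dots> = A"
    using sub by (auto simp: space_PiM)
  finally show ?thesis
    using measurable_sets[OF 2 1] by (simp add: gauss_measure_def)
qed

lemma prob_space_gauss_measure: "prob_space (gauss_measure n)"
proof
  interpret product_sigma_finite "\<lambda>_::nat. lborel :: real measure" ..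
  have pow: "(2 * pi) powr - (real n / 2) = (1 / sqrt (2 * pi)) ^ n"
    by (simp add: powr_half_sqrt[symmetric] powr_minus_divide powr_realpow[symmetric]
        power_divide powr_powr)
  have dens: "(2 * pi) powr (- real n / 2) * exp (- (\<Sum>i<n. (x i)\<^sup>2) / 2)
      = (\<Prod>i<n. std_normal_density (x i))" for x :: "nat \<Rightarrow> real"
    by (simp add: std_normal_density_def pow prod.distrib exp_sum[symmetric] sum_negf
        sum_divide_distrib power_divide prod_dividef)
  have "emeasure (gauss_measure n) (space (gauss_measure n))
      = (\<integral>\<^sup>+x. ennreal (\<Prod>i<n. std_normal_density (x i)) \<partial>PiM {..<n} (\<lambda>_. lborel))"
    unfolding gauss_measure_def dens
    by (subst emeasure_density)
       (auto intro!: nn_integral_cong measurable_component_singleton borel_measurable_prod)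
  also have "\<dots> = (\<integral>\<^sup>+x. (\<Prod>i<n. ennreal (std_normal_density (x i))) \<partial>PiM {..<n} (\<lambda>_. lborel))"
    by (simp add: prod_ennreal)
  also have "\<dots> = (\<Prod>i<n. \<integral>\<^sup>+x. ennreal (std_normal_density x) \<partial>lborel)"
    by (rule product_nn_integral_prod) auto
  also have "(\<integral>\<^sup>+x. ennreal (std_normal_density x) \<partial>lborel) = 1"
    using prob_space.emeasure_space_1[OF prob_space_normal_density[of 1 0]]
    by (simp add: emeasure_density)
  finally show "emeasure (gauss_measure n) (space (gauss_measure n)) = 1"
    by simp
qed

end

theory Submission
  imports Defs
begin

text \<open>
  Tensor power trick: the \<open>k\<close>-fold product of a set in \<open>\<C>\<^sub>n\<close> lies in \<open>\<C>\<^sub>k\<^sub>n\<close>, and its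
  Gaussian measure is the \<open>k\<close>-th power of the original one. Applying the weak inequality in
  dimension \<open>kn\<close> to the \<open>k\<close>-fold products of \<open>A\<close> and \<open>B\<close> and taking \<open>k\<close>-th roots replaces the
  constant \<open>c\<^sub>n\<close> by \<open>(c\<^sub>k\<^sub>n\<^bsup>1/kn\<^esup>)\<^sup>n\<close>, which tends to \<open>1\<close>.
\<close>

text \<open>The coordinates of a point of the \<open>k * n\<close>-dimensional space are read as
  \<open>k\<close> consecutive runs of length \<open>n\<close>. Restricting to \<open>{..<n}\<close>
  puts each run into the carrier of the \<open>n\<close>-dimensional space.\<close>

definition block :: "nat \<Rightarrow> nat \<Rightarrow> (nat \<Rightarrow> 'a) \<Rightarrow> nat \<Rightarrow> 'a" where
  "block n j x = (\<lambda>i\<in>{..<n}. x (j * n + i))"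

text \<open>This is the Cartesian power of \<open>A\<close> after flattening. The blocks with
  \<open>j < k\<close> only see indices below \<open>k * n\<close>, so extensionality has to be
  demanded separately.\<close>

definition set_power :: "nat \<Rightarrow> nat \<Rightarrow> (nat \<Rightarrow> 'a) set \<Rightarrow> (nat \<Rightarrow> 'a) set" where
  "set_power n k A = {x \<in> extensional {..<k * n}. \<forall>j<k. block n j x \<in> A}"

lemma block_index_less: "j < k \<Longrightarrow> i < n \<Longrightarrow> j * n + i < k * (n::nat)"
  using mult_le_mono1[of "Suc j" k n] by simp

lemma set_power_Int: "set_power n k (A \<inter> B) = set_power n k A \<inter> set_power n k B"
  by (auto simp: set_power_def)

text \<open>The density factors into one-dimensional normal densities, and a product measure is
  determined by its values on boxes. This form makes independence of the coordinates
  available.\<close>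

lemma gauss_measure_eq_PiM:
  "gauss_measure n = PiM {..<n} (\<lambda>_. density lborel (\<lambda>x. ennreal (std_normal_density x)))"
proof -
  interpret L: product_sigma_finite "\<lambda>_::nat. lborel :: real measure" ..
  have pow: "(2 * pi) powr - (real n / 2) = (1 / sqrt (2 * pi)) ^ n"
    by (simp add: powr_half_sqrt[symmetric] powr_minus_divide powr_realpow[symmetric]
        power_divide powr_powr)
  have dens: "(2 * pi) powr (- real n / 2) * exp (- (\<Sum>i<n. (x i)\<^sup>2) / 2)
      = (\<Prod>i<n. std_normal_density (x i))" for x :: "nat \<Rightarrow> real"
    by (simp add: std_normal_density_def pow prod.distrib exp_sum[symmetric] sum_negf
        sum_divide_distrib power_divide prod_dividef)
  interpret N: prob_space "density lborel (\<lambda>x. ennreal (std_normal_density x))"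
    by (rule prob_space_normal_density) simp
  interpret P: product_sigma_finite "\<lambda>_::nat. density lborel (\<lambda>x. ennreal (std_normal_density x))"
    ..
  show ?thesis
  proof (rule P.PiM_eqI)
    show "sets (gauss_measure n) =
        sets (PiM {..<n} (\<lambda>_. density lborel (\<lambda>x. ennreal (std_normal_density x))))"
      unfolding gauss_measure_def sets_density by (rule sets_PiM_cong) auto
  next
    fix S :: "nat \<Rightarrow> real set"
    assume "\<And>i. i \<in> {..<n} \<Longrightarrow> S i \<in> sets (density lborel (\<lambda>x. ennreal (std_normal_density x)))"
    then have S: "S i \<in> sets borel" if "i < n" for i
      using that by auto
    have Pi: "Pi\<^sub>E {..<n} S \<in> sets (PiM {..<n} (\<lambda>_. lborel))"
      using S by (intro sets_PiM_I_finite) auto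
    have "emeasure (gauss_measure n) (Pi\<^sub>E {..<n} S)
        = (\<integral>\<^sup>+x. ennreal (\<Prod>i<n. std_normal_density (x i)) * indicator (Pi\<^sub>E {..<n} S) x
             \<partial>PiM {..<n} (\<lambda>_. lborel))"
      unfolding gauss_measure_def dens using Pi
      by (subst emeasure_density)
         (auto intro!: nn_integral_cong measurable_component_singleton borel_measurable_prod)
    also have "\<dots> = (\<integral>\<^sup>+x. (\<Prod>i<n. ennreal (std_normal_density (x i)) * indicator (S i) (x i))
             \<partial>PiM {..<n} (\<lambda>_. lborel))"
    proof (rule nn_integral_cong)
      fix x :: "nat \<Rightarrow> real" assume "x \<in> space (PiM {..<n} (\<lambda>_. lborel))"
      \<comment> \<open>Points of the space are extensional, so lying in the box is a coordinatewise
        condition. The integrand thus splits into functions of one variable each.\<close>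
      then have "indicator (Pi\<^sub>E {..<n} S) x = (\<Prod>i<n. indicator (S i) (x i) :: ennreal)"
        by (auto simp: indicator_def space_PiM PiE_iff)
      then show "ennreal (\<Prod>i<n. std_normal_density (x i)) * indicator (Pi\<^sub>E {..<n} S) x
          = (\<Prod>i<n. ennreal (std_normal_density (x i)) * indicator (S i) (x i))"
        by (simp add: prod.distrib prod_ennreal)
    qed
    also have "\<dots> = (\<Prod>i<n. \<integral>\<^sup>+x. ennreal (std_normal_density x) * indicator (S i) x \<partial>lborel)"
      using S by (intro L.product_nn_integral_prod) auto
    also have "\<dots> = (\<Prod>i<n. emeasure (density lborel (\<lambda>x. ennreal (std_normal_density x))) (S i))"
      using S by (intro prod.cong) (auto simp: emeasure_density)
    finally show "emeasure (gauss_measure n) (Pi\<^sub>E {..<n} S)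
        = (\<Prod>i<n. emeasure (density lborel (\<lambda>x. ennreal (std_normal_density x))) (S i))" .
  qed simp
qed

text \<open>Blocks use disjoint sets of independent coordinates, hence are independent, and each has
  the law of \<open>n\<close> copies of \<open>N\<close>. The probability that all lie in
  \<open>A\<close> is a product of \<open>k\<close> equal factors.\<close>

lemma measure_PiM_set_power:
  assumes "prob_space N" and A: "A \<in> sets (PiM {..<n} (\<lambda>_. N))"
    and "n \<ge> 1" "k \<ge> 1" and N: "space N = UNIV"
  shows "measure (PiM {..<k * n} (\<lambda>_. N)) (set_power n k A)
    = measure (PiM {..<n} (\<lambda>_. N)) A ^ k"
proof -
  interpret N: prob_space N by fact
  let ?P = "PiM {..<k * n} (\<lambda>_. N)"
  interpret P: prob_space ?P
    by (intro prob_space_PiM assms(1))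
  define K where "K = (\<lambda>j::nat. {j * n..<j * n + n})"
  \<comment> \<open>Independence means that the joint law is the product of the marginals. Here the
    joint map is the identity on the space, and each marginal is \<open>N\<close>. The criterion
    asks for a nonempty index set, whence \<open>n \<ge> 1\<close> and
    \<open>k \<ge> 1\<close>.\<close>
  have "P.indep_vars (\<lambda>_. N) (\<lambda>i x. x i) {..<k * n}"
  proof (subst P.indep_vars_iff_distr_eq_PiM')
    have "distr ?P ?P (\<lambda>x. \<lambda>i\<in>{..<k * n}. x i) = distr ?P ?P (\<lambda>x. x)"
      by (intro distr_cong) (auto simp: space_PiM)
    also have "\<dots> = ?P"
      by (simp add: distr_id2)
    also have "\<dots> = (PiM {..<k * n} (\<lambda>i. distr ?P N (\<lambda>x. x i)))"
      by (intro PiM_cong refl distr_PiM_component[symmetric] assms(1))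
    finally show "distr ?P ?P (\<lambda>x. \<lambda>i\<in>{..<k * n}. x i)
        = (PiM {..<k * n} (\<lambda>i. distr ?P N (\<lambda>x. x i)))" .
    show "{..<k * n} \<noteq> {}"
      using \<open>n \<ge> 1\<close> \<open>k \<ge> 1\<close> by (auto simp: lessThan_empty_iff)
  qed auto
  then have "P.indep_vars (\<lambda>j. PiM (K j) (\<lambda>_. N)) (\<lambda>j x. restrict (\<lambda>i. x i) (K j)) {..<k}"
  proof (rule P.indep_vars_restrict)
    fix j assume "j \<in> {..<k}"
    then show "K j \<subseteq> {..<k * n}"
      using mult_le_mono1[of "Suc j" k n] by (auto simp: K_def)
  next
    have "i = j" if "m \<in> K i" "m \<in> K j" for i j m
    proof -
      have "m div n = i" if "m \<in> K i" for i
        using that by (intro div_nat_eqI) (auto simp: K_def algebra_simps)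
      then show ?thesis using that by metis
    qed
    then show "disjoint_family_on K {..<k}"
      by (auto simp: disjoint_family_on_def)
  qed
  \<comment> \<open>Shifting the indices in \<open>K j\<close> down to \<open>{..<n}\<close> is
    measurable, so independence survives and all variables now take values in one common
    space.\<close>
  then have "P.indep_vars (\<lambda>j. PiM {..<n} (\<lambda>_. N))
      (\<lambda>j x. block n j (restrict (\<lambda>i. x i) (K j))) {..<k}"
  proof (rule P.indep_vars_compose2)
    fix j
    show "block n j \<in> measurable (PiM (K j) (\<lambda>_. N)) (PiM {..<n} (\<lambda>_. N))"
      unfolding block_def
      by (intro measurable_restrict measurable_component_singleton) (auto simp: K_def)
  qed
  moreover have "block n j (restrict (\<lambda>i. x i) (K j)) = block n j x" for j and x :: "nat \<Rightarrow> 'a"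
    by (auto simp: block_def K_def)
  ultimately have "P.indep_vars (\<lambda>j. PiM {..<n} (\<lambda>_. N)) (block n) {..<k}"
    by simp
  then have "P.prob (\<Inter>j\<in>{..<k}. block n j -` A \<inter> space ?P)
      = (\<Prod>j<k. P.prob (block n j -` A \<inter> space ?P))"
    by (rule P.indep_varsD) (use A \<open>k \<ge> 1\<close> in \<open>auto simp: lessThan_empty_iff\<close>)
  \<comment> \<open>As \<open>k \<ge> 1\<close>, the intersection is nonvacuous and stays inside the
    space; as \<open>space N = UNIV\<close>, lying in the space is just extensionality.\<close>
  also have "(\<Inter>j\<in>{..<k}. block n j -` A \<inter> space ?P) = set_power n k A"
    using \<open>k \<ge> 1\<close> by (auto simp: set_power_def space_PiM PiE_def N Suc_le_eq)
  also have "(\<Prod>j<k. P.prob (block n j -` A \<inter> space ?P))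
      = (\<Prod>j<k. measure (PiM {..<n} (\<lambda>_. N)) A)"
  proof (rule prod.cong)
    fix j assume "j \<in> {..<k}"
    then have j: "j < k" by simp
    have "block n j \<in> measurable ?P (PiM {..<n} (\<lambda>_. N))"
      unfolding block_def using block_index_less[OF j]
      by (intro measurable_restrict measurable_component_singleton) auto
    then have "P.prob (block n j -` A \<inter> space ?P)
        = measure (distr ?P (PiM {..<n} (\<lambda>_. N)) (block n j)) A"
      using A by (simp add: measure_distr)
    \<comment> \<open>The index map \<open>i \<mapsto> j * n + i\<close> is injective, and
      projecting a product of copies of \<open>N\<close> to distinct coordinates gives again such a
      product.\<close>
    also have "distr ?P (PiM {..<n} (\<lambda>_. N)) (block n j) = PiM {..<n} (\<lambda>_. N)"
      unfolding block_def using block_index_less[OF j]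
      by (intro distr_PiM_reindex) (auto simp: inj_on_def \<open>prob_space N\<close>)
    finally show "P.prob (block n j -` A \<inter> space ?P) = measure (PiM {..<n} (\<lambda>_. N)) A" .
  qed simp
  finally show ?thesis
    by simp
qed

lemma measure_gauss_measure_set_power:
  assumes "A \<in> sets (gauss_measure n)" "n \<ge> 1" "k \<ge> 1"
  shows "measure (gauss_measure (k * n)) (set_power n k A) = measure (gauss_measure n) A ^ k"
  using assms unfolding gauss_measure_eq_PiM
  by (intro measure_PiM_set_power prob_space_normal_density) auto

text \<open>Taking a block commutes with coordinatewise linear operations, so the condition can be
  checked in each factor.\<close>

lemma convex_Rn_set_power:
  assumes "convex_Rn n A"
  shows "convex_Rn (k * n) (set_power n k A)"
  unfolding convex_Rn_def
proof (intro ballI allI impI)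
  fix x y :: "nat \<Rightarrow> real" and u v :: real
  assume *: "x \<in> set_power n k A" "y \<in> set_power n k A" "u \<ge> 0" "v \<ge> 0" "u + v = 1"
  let ?z = "\<lambda>i\<in>{..<k * n}. u * x i + v * y i"
  have "block n j ?z \<in> A" if "j < k" for j
  proof -
    have "block n j ?z = (\<lambda>i\<in>{..<n}. u * block n j x i + v * block n j y i)"
      using block_index_less[OF that] by (auto simp: block_def)
    then show ?thesis
      using assms * that by (simp add: convex_Rn_def set_power_def)
  qed
  then show "?z \<in> set_power n k A"
    by (auto simp: set_power_def)
qed

text \<open>Negation is an involution on extensional functions, so stability of \<open>A\<close>
  under it already forces equality of \<open>A\<close> with its image.\<close>

lemma symmetric_Rn_iff:
  assumes "A \<subseteq> extensional {..<n}"
  shows "symmetric_Rn n A \<longleftrightarrow> (\<forall>x\<in>A. (\<lambda>i\<in>{..<n}. - x i) \<in> A)"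
proof
  assume "\<forall>x\<in>A. (\<lambda>i\<in>{..<n}. - x i) \<in> A"
  moreover have "x = (\<lambda>i\<in>{..<n}. - (\<lambda>i\<in>{..<n}. - x i) i)" if "x \<in> A" for x
    using assms that by (auto simp: extensional_def fun_eq_iff)
  ultimately show "symmetric_Rn n A"
    unfolding symmetric_Rn_def by blast
qed (auto simp: symmetric_Rn_def)

lemma symmetric_Rn_set_power:
  assumes "A \<subseteq> extensional {..<n}" "symmetric_Rn n A"
  shows "symmetric_Rn (k * n) (set_power n k A)"
proof -
  have "(\<lambda>i\<in>{..<k * n}. - x i) \<in> set_power n k A" if x: "x \<in> set_power n k A" for x
  proof -
    have "block n j (\<lambda>i\<in>{..<k * n}. - x i) \<in> A" if "j < k" for j
    proof -
      have "block n j (\<lambda>i\<in>{..<k * n}. - x i) = (\<lambda>i\<in>{..<n}. - block n j x i)"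
        using block_index_less[OF that] by (auto simp: block_def)
      then show ?thesis
        using assms x that by (simp add: symmetric_Rn_iff set_power_def)
    qed
    then show ?thesis
      by (auto simp: set_power_def)
  qed
  then show ?thesis
    by (subst symmetric_Rn_iff) (auto simp: set_power_def)
qed

text \<open>The power is the intersection of the preimages of \<open>A\<close> under the continuous
  block maps; \<open>k \<ge> 1\<close> makes this family nonempty.\<close>

lemma closedin_set_power:
  assumes "closedin (powertop_real {..<n}) A" "k \<ge> 1"
  shows "closedin (powertop_real {..<k * n}) (set_power n k A)"
proof -
  let ?T = "powertop_real {..<k * n}"
  have "closedin ?T {x \<in> topspace ?T. block n j x \<in> A}" if "j < k" for j
  proof (rule closedin_continuous_map_preimage[OF _ assms(1)])
    show "continuous_map ?T (powertop_real {..<n}) (block n j)"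
      using block_index_less[OF that]
      by (auto simp: continuous_map_componentwise block_def
          intro!: continuous_map_product_projection)
  qed
  then have "closedin ?T (\<Inter>j\<in>{..<k}. {x \<in> topspace ?T. block n j x \<in> A})"
    using assms(2) by (intro closedin_INT) (auto simp: Suc_le_eq)
  also have "(\<Inter>j\<in>{..<k}. {x \<in> topspace ?T. block n j x \<in> A}) = set_power n k A"
    using assms(2) by (auto simp: set_power_def PiE_def Suc_le_eq)
  finally show ?thesis .
qed

lemma sym_closed_convex_set_power:
  assumes "A \<in> sym_closed_convex n" "k \<ge> 1"
  shows "set_power n k A \<in> sym_closed_convex (k * n)"
proof -
  have "A \<subseteq> extensional {..<n}"
    using assms closedin_subset[of "powertop_real {..<n}" A]
    by (auto simp: sym_closed_convex_def PiE_def)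
  then show ?thesis
    using assms by (simp add: sym_closed_convex_def closedin_set_power convex_Rn_set_power
        symmetric_Rn_set_power)
qed

theorem proposition4:
  fixes c :: "nat \<Rightarrow> real"
  assumes "\<And>n. n \<ge> 1 \<Longrightarrow> c n > 0"
    and "(\<lambda>n. c n powr (1 / real n)) \<longlonglongrightarrow> 1"
    and "\<And>n A B. n \<ge> 1 \<Longrightarrow> A \<in> sym_closed_convex n \<Longrightarrow> B \<in> sym_closed_convex n \<Longrightarrow>
           measure (gauss_measure n) (A \<inter> B)
             \<ge> c n * measure (gauss_measure n) A * measure (gauss_measure n) B"
  shows "\<forall>n\<ge>1. \<forall>A\<in>sym_closed_convex n. \<forall>B\<in>sym_closed_convex n.
           measure (gauss_measure n) (A \<inter> B)
             \<ge> measure (gauss_measure n) A * measure (gauss_measure n) B"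
proof (intro allI impI ballI)
  fix n :: nat and A B :: "(nat \<Rightarrow> real) set"
  assume n: "n \<ge> 1" and A: "A \<in> sym_closed_convex n" and B: "B \<in> sym_closed_convex n"
  define p where "p = measure (gauss_measure n) (A \<inter> B)"
  define q where "q = measure (gauss_measure n) A * measure (gauss_measure n) B"
  define d where "d = (\<lambda>m. c m powr (1 / real m))"
  have sets: "A \<in> sets (gauss_measure n)" "B \<in> sets (gauss_measure n)"
    using A B by (auto simp: sym_closed_convex_def intro: closedin_imp_sets_gauss_measure)
  have bound: "d (k * n) ^ n * q \<le> p" if k: "k \<ge> 1" for k
  proof -
    have kn: "k * n \<ge> 1"
      using k n by simp
    \<comment> \<open>Since \<open>c (k * n)\<close> is positive, \<open>d (k * n)\<close> is its
      genuine root of order \<open>k * n\<close>.\<close>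
    have "(d (k * n) ^ n) ^ k = c (k * n)"
      using assms(1)[OF kn] n k
      by (simp add: d_def power_mult[symmetric] powr_power mult.commute)
    then have "(d (k * n) ^ n * q) ^ k = c (k * n) * q ^ k"
      by (simp add: power_mult_distrib)
    \<comment> \<open>The assumed inequality is used in dimension \<open>k * n\<close>. Powers
      commute with intersection, so all three measures in it are \<open>k\<close>-th powers.\<close>
    also have "\<dots> \<le> p ^ k"
      using assms(3)[OF kn sym_closed_convex_set_power[OF A k] sym_closed_convex_set_power[OF B k]]
        sets n k
      by (simp add: set_power_Int[symmetric] measure_gauss_measure_set_power p_def q_def
          power_mult_distrib mult.assoc)
    finally show ?thesis
      \<comment> \<open>The \<open>k\<close>-th root is taken on both sides, using
        \<open>p \<ge> 0\<close>; the rule is stated for the exponent \<open>Suc (k - 1)\<close>,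
        which is \<open>k\<close>.\<close>
      using k power_le_imp_le_base[of _ "k - 1" p] by (simp add: p_def)
  qed
  have "filterlim (\<lambda>k. k * n) at_top sequentially"
    using n by (intro filterlim_subseq) (simp add: strict_mono_def)
  then have "(\<lambda>k. d (k * n)) \<longlonglongrightarrow> 1"
    using assms(2) unfolding d_def by (rule filterlim_compose[rotated])
  \<comment> \<open>The exponent \<open>n\<close> stays fixed while \<open>k\<close> grows, so the
    whole constant tends to \<open>1\<close>.\<close>
  then have "(\<lambda>k. d (k * n) ^ n * q) \<longlonglongrightarrow> 1 ^ n * q"
    by (intro tendsto_intros)
  then have "1 ^ n * q \<le> p"
    by (rule LIMSEQ_le_const2) (use bound in blast)
  then show "measure (gauss_measure n) A * measure (gauss_measure n) B
      \<le> measure (gauss_measure n) (A \<inter> B)"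
    by (simp add: p_def q_def)
qed

end
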